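(* Let $p$ be an odd prime and $r\ge1$ an integer. The linear complexity over $\mathbb{F}_p$ of the sequence $(H_{r-1}(u))_{u\ge0}$ (viewed as a sequence over $\mathbb{F}_p$) equals $p^{r}+p-1$.
   Context: Let $\varphi$ be Euler's totient function. For an integer $r\ge1$, the Euler quotient $Q_r(u)$ is the unique integer with $0\le Q_r(u)<p^r$ and $Q_r(u)\equiv \frac{u^{\varphi(p^r)}-1}{p^r}\pmod{p^r}$ when $\gcd(u,p)=1$; and $Q_r(u)=0$ when $p\mid u$. One has $Q_r(u)\equiv Q_{r-1}(u)\pmod{p^{r-1}}$ for $r\ge2$. Define $H_0(u)=Q_1(u)$ and, for $r\ge2$, $H_{r-1}(u)$ as the unique integer with $0\le H_{r-1}(u)<p$ and $H_{r-1}(u)\equiv \frac{Q_r(u)-Q_{r-1}(u)}{p^{r-1}}\pmod p$ (the highest $p$-adic digit of $Q_r(u)$). The linear complexity over a field $\mathbb{F}$ of a periodic sequence $(s(u))_{u\ge0}$ is the least $L$ such that there are $c_0\ne0,c_1,\dots,c_{L-1}\in\mathbb{F}$ with $s(u+L)=c_{L-1}s(u+L-1)+\dots+c_0s(u)$ for all $u\ge0$. *)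

theory Defs
  imports "HOL-Number_Theory.Number_Theory"
begin

definition euler_quotient :: "nat \<Rightarrow> nat \<Rightarrow> nat \<Rightarrow> int" where
  "euler_quotient p r u =
     (if coprime u p
      then ((int u ^ totient (p ^ r) - 1) div int (p ^ r)) mod int (p ^ r)
      else 0)"

text \<open>The division in the definition is exact, by Euler's theorem.\<close>

lemma euler_quotient_dvd:
  assumes "coprime u p"
  shows "int (p ^ r) dvd int u ^ totient (p ^ r) - 1"
proof -
  have "[u ^ totient (p ^ r) = 1] (mod p ^ r)"
    using assms by (intro euler_theorem) simp
  then have "[int (u ^ totient (p ^ r)) = int 1] (mod int (p ^ r))"
    by (simp only: cong_int_iff)
  then show ?thesis
    by (simp add: cong_iff_dvd_diff)
qed

text \<open>
  The index \<open>k\<close> is the position of the \<open>p\<close>-adic digit, so \<open>euler_digit p k\<close> is the highest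
  digit of \<open>euler_quotient p (k + 1)\<close>. For an odd prime \<open>p\<close> the division below is exact, because
  then \<open>euler_quotient p (Suc (Suc k)) u\<close> and \<open>euler_quotient p (Suc k) u\<close> are congruent
  modulo \<open>p ^ Suc k\<close>.
\<close>

fun euler_digit :: "nat \<Rightarrow> nat \<Rightarrow> nat \<Rightarrow> int" where
  "euler_digit p 0 u = euler_quotient p 1 u"
| "euler_digit p (Suc k) u =
     ((euler_quotient p (Suc (Suc k)) u - euler_quotient p (Suc k) u) div int (p ^ Suc k)) mod int p"

text \<open>
  The condition \<open>c 0 \<noteq> \<zero>\<close> is vacuous for \<open>L = 0\<close>, where there are no coefficients: the
  zero sequence has linear complexity \<open>0\<close>. For a sequence that is not periodic
  the set of admissible \<open>L\<close> may be empty, and then the value is unspecified.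
\<close>

definition linear_complexity :: "('a, 'm) ring_scheme \<Rightarrow> (nat \<Rightarrow> 'a) \<Rightarrow> nat" where
  "linear_complexity F s =
     (LEAST L. \<exists>c. (\<forall>i<L. c i \<in> carrier F) \<and> (L > 0 \<longrightarrow> c 0 \<noteq> \<zero>\<^bsub>F\<^esub>) \<and>
        (\<forall>u. s (u + L) = (\<Oplus>\<^bsub>F\<^esub>i\<in>{..<L}. c i \<otimes>\<^bsub>F\<^esub> s (u + i))))"

end

theory Submission
  imports Defs
begin

text \<open>
  Expanding \<open>(u + p\<^sup>r) ^ \<phi>(p\<^sup>r)\<close> to first order shows that the highest digit \<open>H\<close> of the Euler
  quotient satisfies \<open>H (u + p\<^sup>r) - H u = - u ^ (p - 2)\<close> modulo \<open>p\<close>, for all \<open>u\<close>. Let \<open>\<Delta>\<close> be the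
  forward difference. In characteristic \<open>p\<close> the left-hand side is \<open>\<Delta>\<close> iterated \<open>p\<^sup>r\<close> times
  on \<open>H\<close>, while the right-hand side is a polynomial of degree \<open>p - 2\<close>: it is killed by
  \<open>p - 1\<close> further differences, but \<open>p - 2\<close> of them give the constant \<open>- (p - 2)!\<close>, which is
  nonzero modulo \<open>p\<close>. So the minimal polynomial of \<open>H\<close> is the \<open>(p\<^sup>r + p - 1)\<close>-th power of \<open>X - 1\<close>.
\<close>

section \<open>Forward differences\<close>

definition fdiff :: "(nat \<Rightarrow> 'a::comm_ring_1) \<Rightarrow> nat \<Rightarrow> 'a" where
  "fdiff s u = s (Suc u) - s u"

lemma fdiff_funpow_Suc: "(fdiff ^^ Suc n) s u = (fdiff ^^ n) s (Suc u) - (fdiff ^^ n) s u"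
  by (simp add: fdiff_def)

lemma fdiff_funpow_diff:
  "(fdiff ^^ n) (\<lambda>u. f u - g u) u = (fdiff ^^ n) f u - (fdiff ^^ n) g u"
  by (induction n arbitrary: u) (simp_all add: fdiff_def)

lemma fdiff_funpow_cmult: "(fdiff ^^ n) (\<lambda>u. c * f u) u = c * (fdiff ^^ n) f u"
  by (induction n arbitrary: u) (simp_all add: fdiff_def right_diff_distrib)

lemma fdiff_funpow_sum:
  "(fdiff ^^ n) (\<lambda>u. \<Sum>i\<in>A. f i u) u = (\<Sum>i\<in>A. (fdiff ^^ n) (f i) u)"
  by (induction n arbitrary: u) (simp_all add: fdiff_def sum_subtractf)

lemma dvd_fdiff_funpow:
  assumes "\<And>u. m dvd s u"
  shows "m dvd (fdiff ^^ n) s u"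
  using assms by (induction n arbitrary: u) (simp_all add: fdiff_def)

lemma cong_fdiff_funpow:
  fixes f g :: "nat \<Rightarrow> int"
  assumes "\<And>u. [f u = g u] (mod m)"
  shows "[(fdiff ^^ n) f u = (fdiff ^^ n) g u] (mod m)"
  using dvd_fdiff_funpow[of m "\<lambda>u. f u - g u" n u] assms
  by (simp add: fdiff_funpow_diff cong_iff_dvd_diff)

text \<open>Pascal's rule. The weight \<open>a\<close> serves both expansions below:
  \<open>a = - 1\<close> for iterated differences, \<open>a = 1\<close> for Newton's
  formula.\<close>

lemma sum_binomial_Suc:
  fixes a :: "'a::comm_ring_1"
  shows "(\<Sum>i\<le>Suc n. of_nat (Suc n choose i) * a ^ (Suc n - i) * F i) =
    a * (\<Sum>i\<le>n. of_nat (n choose i) * a ^ (n - i) * F i) +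
    (\<Sum>i\<le>n. of_nat (n choose i) * a ^ (n - i) * F (Suc i))"
proof -
  have "a * (\<Sum>i\<le>n. of_nat (n choose i) * a ^ (n - i) * F i) =
      (\<Sum>i\<le>n. of_nat (n choose i) * a ^ (Suc n - i) * F i)"
    by (auto simp: sum_distrib_left Suc_diff_le intro!: sum.cong)
  also have "\<dots> = (\<Sum>i\<le>Suc n. of_nat (n choose i) * a ^ (Suc n - i) * F i)"
    by (simp add: binomial_eq_0)
  also have "\<dots> = a ^ Suc n * F 0 + (\<Sum>i\<le>n. of_nat (n choose Suc i) * a ^ (n - i) * F (Suc i))"
    by (subst sum.atMost_Suc_shift) simp
  finally show ?thesis
    by (subst sum.atMost_Suc_shift) (simp add: sum.distrib algebra_simps)
qed

text \<open>The binomial theorem for (E - 1)^n, with E the shift operator.\<close>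

lemma fdiff_funpow_binomial:
  "(fdiff ^^ n) s u = (\<Sum>i\<le>n. of_nat (n choose i) * (- 1) ^ (n - i) * s (u + i))"
proof (induction n arbitrary: u)
  case (Suc n)
  show ?case
    unfolding fdiff_funpow_Suc Suc sum_binomial_Suc[where F = "\<lambda>i. s (u + i)"] by simp
qed simp

text \<open>Dually, E^n = (1 + \<open>fdiff\<close>)^n.\<close>

lemma newton_forward: "s (u + n) = (\<Sum>i\<le>n. of_nat (n choose i) * (fdiff ^^ i) s u)"
proof (induction n arbitrary: u)
  case (Suc n)
  have "s (u + Suc n) = (\<Sum>i\<le>n. of_nat (n choose i) * (fdiff ^^ i) s (Suc u))"
    using Suc[of "Suc u"] by simp
  also have "\<dots> = (\<Sum>i\<le>n. of_nat (n choose i) * (fdiff ^^ i) s u) +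
      (\<Sum>i\<le>n. of_nat (n choose i) * (fdiff ^^ Suc i) s u)"
    unfolding sum.distrib[symmetric] fdiff_funpow_Suc by (simp add: algebra_simps)
  also have "\<dots> = (\<Sum>i\<le>Suc n. of_nat (Suc n choose i) * (fdiff ^^ i) s u)"
    using sum_binomial_Suc[of n 1 "\<lambda>i. (fdiff ^^ i) s u"] by simp
  finally show ?case .
qed simp

text \<open>Product rule; only two terms survive because the second difference of the identity is
  zero.\<close>

lemma fdiff_funpow_leibniz:
  "(fdiff ^^ Suc n) (\<lambda>u. of_nat u * f u) u =
    of_nat (u + Suc n) * (fdiff ^^ Suc n) f u + of_nat (Suc n) * (fdiff ^^ n) f u"
proof (induction n arbitrary: u)
  case 0
  show ?case by (simp add: fdiff_def algebra_simps)
next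
  case (Suc n)
  show ?case
    unfolding fdiff_funpow_Suc[of "Suc n"] Suc
    unfolding fdiff_funpow_Suc by (simp add: algebra_simps)
qed

text \<open>Both claims go through one induction: the product rule for u * u^n uses the value of the
  n-th difference and the vanishing of the later ones.\<close>

lemma fdiff_funpow_power:
  "(fdiff ^^ n) (\<lambda>u. of_nat u ^ n) u = (fact n :: 'a::{comm_ring_1,semiring_char_0}) \<and>
    (\<forall>m>n. (fdiff ^^ m) (\<lambda>u. of_nat u ^ n :: 'a) u = 0)"
proof (induction n arbitrary: u)
  case 0
  have "(fdiff ^^ Suc m) (\<lambda>u. 1 :: 'a) v = 0" for m v
    by (induction m arbitrary: v) (simp_all add: fdiff_def)
  then show ?case
    by (auto simp: gr0_conv_Suc simp del: funpow.simps)
next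
  case (Suc n)
  show ?case
  proof (intro conjI allI impI)
    show "(fdiff ^^ Suc n) (\<lambda>u. of_nat u ^ Suc n :: 'a) u = fact (Suc n)"
      unfolding power_Suc fdiff_funpow_leibniz using Suc[of u] by (simp del: funpow.simps)
  next
    fix m assume "Suc n < m"
    then obtain k where k: "m = Suc k" "n < k"
      using Suc_lessE by blast
    show "(fdiff ^^ m) (\<lambda>u. of_nat u ^ Suc n :: 'a) u = 0"
      unfolding power_Suc k(1) fdiff_funpow_leibniz using Suc[of u] k(2) by (simp del: funpow.simps)
  qed
qed

section \<open>Forward differences modulo a prime\<close>

text \<open>By absorption, \<open>p ^ r\<close> divides i times the binomial; if p did not divide
  the binomial, \<open>p ^ r\<close> would divide the smaller number i.\<close>

lemma prime_dvd_choose_prime_power: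
  fixes p :: nat
  assumes "prime p" "0 < i" "i < p ^ r"
  shows "p dvd (p ^ r choose i)"
proof (rule ccontr)
  assume "\<not> p dvd (p ^ r choose i)"
  then have "coprime (p ^ r) (p ^ r choose i)"
    using assms by (simp add: prime_imp_coprime)
  moreover have "p ^ r dvd i * (p ^ r choose i)"
    using times_binomial_minus1_eq[of i "p ^ r"] assms by simp
  ultimately have "p ^ r dvd i"
    by (simp add: coprime_dvd_mult_left_iff)
  then show False
    using assms by (simp add: nat_dvd_not_less)
qed

text \<open>Frobenius: (E - 1)^q = E^q - 1 modulo p for q = \<open>p ^ r\<close>. Oddness of p gives
  the sign of the last term.\<close>

lemma cong_fdiff_prime_power:
  fixes s :: "nat \<Rightarrow> int"
  assumes "prime p" "odd p"
  shows "[(fdiff ^^ (p ^ r)) s u = s (u + p ^ r) - s u] (mod int p)"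
proof -
  define f where "f i = of_nat (p ^ r choose i) * (- 1) ^ (p ^ r - i) * s (u + i)" for i
  have pos: "p ^ r > 0"
    using assms prime_gt_0_nat by simp
  have "(fdiff ^^ (p ^ r)) s u = (\<Sum>i\<le>p ^ r. f i)"
    unfolding f_def by (rule fdiff_funpow_binomial)
  also have "{..p ^ r} = insert 0 (insert (p ^ r) {0<..<p ^ r})"
    using pos by auto
  also have "sum f \<dots> = s (u + p ^ r) - s u + (\<Sum>i\<in>{0<..<p ^ r}. f i)"
    using pos assms by (simp add: f_def)
  also have "[\<dots> = s (u + p ^ r) - s u + 0] (mod int p)"
  proof (intro cong_add cong_refl)
    have "int p dvd f i" if "i \<in> {0<..<p ^ r}" for i
      using prime_dvd_choose_prime_power[of p i r] that assms
      by (simp add: f_def)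
    then have "int p dvd (\<Sum>i\<in>{0<..<p ^ r}. f i)"
      by (rule dvd_sum)
    then show "[(\<Sum>i\<in>{0<..<p ^ r}. f i) = 0] (mod int p)"
      by (simp add: cong_0_iff)
  qed
  finally show ?thesis by simp
qed

section \<open>Linear complexity over residue rings\<close>

lemma linear_complexity_residue_ring:
  assumes "m > 1" and s: "\<And>u. s u \<in> {0..<m}"
  shows "linear_complexity (residue_ring m) s =
    (LEAST L. \<exists>c. (\<forall>i<L. c i \<in> {0..<m}) \<and> (L > 0 \<longrightarrow> c 0 \<noteq> 0) \<and>
      (\<forall>u. [s (u + L) = (\<Sum>i<L. c i * s (u + i))] (mod m)))"
proof -
  interpret residues m "residue_ring m"
    using assms by unfold_locales
  have carrier: "carrier (residue_ring m) = {0..<m}"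
    by (auto simp: res_carrier_eq)
  have sum: "(\<Oplus>\<^bsub>residue_ring m\<^esub>i\<in>{..<L}. c i \<otimes>\<^bsub>residue_ring m\<^esub> s (u + i)) =
      (\<Sum>i<L. c i * s (u + i)) mod m" for L c u
    by (simp add: res_mult_eq sum_cong)
  have cong: "s v = x mod m \<longleftrightarrow> [s v = x] (mod m)" for v x
    using s[of v] by (simp add: cong_def)
  show ?thesis
    unfolding linear_complexity_def carrier sum cong res_zero_eq ..
qed

text \<open>
  Over \<open>\<int>/p\<close>, the minimal polynomial of \<open>s\<close> is \<open>(X - 1) ^ Suc n\<close>. For minimality, expand an
  annihilating polynomial in powers of \<open>X - 1\<close> and apply a suitable power of \<open>fdiff\<close> to isolate the
  lowest nonzero coefficient.
\<close>
lemma linear_complexity_fdiff: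
  fixes p n :: nat and s :: "nat \<Rightarrow> int"
  assumes p: "prime p" and s: "\<And>u. s u \<in> {0..<int p}"
    and zero: "\<And>u. int p dvd (fdiff ^^ Suc n) s u"
    and nz: "\<not> int p dvd (fdiff ^^ n) s v"
  shows "linear_complexity (residue_ring (int p)) s = Suc n"
proof -
  have p1: "int p > 1"
    using p prime_gt_1_nat by simp
  have high: "int p dvd (fdiff ^^ m) s u" if "m > n" for m u
  proof -
    have "m = (m - Suc n) + Suc n"
      using that by simp
    then obtain k where m: "m = k + Suc n"
      by blast
    show ?thesis
      unfolding m funpow_add o_apply by (rule dvd_fdiff_funpow) (rule zero)
  qed
  show ?thesis
    unfolding linear_complexity_residue_ring[OF p1 s]
  proof (rule Least_equality)
    \<comment> \<open>These are the coefficients of X^(n+1) - (X - 1)^(n+1), reduced modulo p; the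
      one at 0 is a sign, hence a unit.\<close>
    define c where "c i = - (int (Suc n choose i) * (- 1) ^ (Suc n - i)) mod int p" for i
    have "\<forall>i<Suc n. c i \<in> {0..<int p}"
      using p1 by (simp add: c_def)
    moreover have "c 0 \<noteq> 0"
    proof
      assume "c 0 = 0"
      then have "int p dvd (- 1) ^ n"
        by (simp add: c_def mod_eq_0_iff_dvd)
      then show False
        using p1 by (cases "even n") auto
    qed
    moreover have "[s (u + Suc n) = (\<Sum>i<Suc n. c i * s (u + i))] (mod int p)" for u
    proof -
      have "[(\<Sum>i<Suc n. c i * s (u + i)) =
          (\<Sum>i<Suc n. - (int (Suc n choose i) * (- 1) ^ (Suc n - i)) * s (u + i))] (mod int p)"
        by (intro cong_sum cong_mult cong_refl) (simp add: c_def)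
      also have "(\<Sum>i<Suc n. - (int (Suc n choose i) * (- 1) ^ (Suc n - i)) * s (u + i)) =
          s (u + Suc n) - (fdiff ^^ Suc n) s u"
        unfolding fdiff_funpow_binomial
        by (simp add: lessThan_Suc_atMost sum_negf del: binomial_Suc_Suc)
      also have "[\<dots> = s (u + Suc n)] (mod int p)"
        using zero by (simp add: cong_iff_dvd_diff del: funpow.simps)
      finally show ?thesis
        by (rule cong_sym)
    qed
    ultimately show "\<exists>c. (\<forall>i<Suc n. c i \<in> {0..<int p}) \<and> (Suc n > 0 \<longrightarrow> c 0 \<noteq> 0) \<and>
        (\<forall>u. [s (u + Suc n) = (\<Sum>i<Suc n. c i * s (u + i))] (mod int p))"
      by blast
  next
    fix L
    assume "\<exists>c. (\<forall>i<L. c i \<in> {0..<int p}) \<and> (L > 0 \<longrightarrow> c 0 \<noteq> 0) \<and>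
        (\<forall>u. [s (u + L) = (\<Sum>i<L. c i * s (u + i))] (mod int p))"
    then obtain c where c: "\<And>u. [s (u + L) = (\<Sum>i<L. c i * s (u + i))] (mod int p)"
      by blast
    show "Suc n \<le> L"
    proof (rule ccontr)
      assume "\<not> Suc n \<le> L"
      then have L: "L \<le> n"
        by simp
      \<comment> \<open>\<open>a\<close> lists the coefficients of the monic annihilating
        polynomial, \<open>d\<close> those of its expansion in powers of X - 1.\<close>
      define a where "a i = (if i < L then - c i else 1)" for i
      define d where "d j = (\<Sum>i\<le>L. a i * int (i choose j))" for j
      have rel: "int p dvd (\<Sum>j\<le>L. d j * (fdiff ^^ j) s u)" for u
      proof -
        have "(\<Sum>j\<le>L. d j * (fdiff ^^ j) s u) =
            (\<Sum>j\<le>L. \<Sum>i\<le>L. a i * (int (i choose j) * (fdiff ^^ j) s u))"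
          by (simp add: d_def sum_distrib_right mult.assoc)
        also have "\<dots> = (\<Sum>i\<le>L. \<Sum>j\<le>L. a i * (int (i choose j) * (fdiff ^^ j) s u))"
          by (rule sum.swap)
        also have "\<dots> = (\<Sum>i\<le>L. a i * s (u + i))"
        proof (rule sum.cong[OF refl])
          fix i assume "i \<in> {..L}"
          then have "(\<Sum>j\<le>L. int (i choose j) * (fdiff ^^ j) s u) =
              (\<Sum>j\<le>i. int (i choose j) * (fdiff ^^ j) s u)"
            by (intro sum.mono_neutral_right) auto
          also have "\<dots> = s (u + i)"
            by (simp add: newton_forward)
          finally show "(\<Sum>j\<le>L. a i * (int (i choose j) * (fdiff ^^ j) s u)) = a i * s (u + i)"
            by (simp flip: sum_distrib_left)
        qed
        also have "\<dots> = s (u + L) - (\<Sum>i<L. c i * s (u + i))"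
          unfolding lessThan_Suc_atMost[symmetric] by (simp add: a_def sum_negf)
        finally show ?thesis
          using c[of u] by (simp add: cong_iff_dvd_diff)
      qed
      have "int p dvd d j" if "j \<le> L" for j
        using that
      proof (induction j rule: less_induct)
        case (less j)
        \<comment> \<open>After n - j more differences, terms with i < j vanish by induction and
          those with i > j have order above n. What remains is \<open>d j\<close> times the nonzero
          n-th difference.\<close>
        let ?D = "\<lambda>i. d i * (fdiff ^^ (n - j + i)) s v"
        have "int p dvd (fdiff ^^ (n - j)) (\<lambda>u. \<Sum>i\<le>L. d i * (fdiff ^^ i) s u) v"
          by (rule dvd_fdiff_funpow) (rule rel)
        also have "\<dots> = (\<Sum>i\<le>L. ?D i)"
          by (simp add: fdiff_funpow_sum fdiff_funpow_cmult funpow_add)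
        also have "\<dots> = ?D j + (\<Sum>i\<in>{..L} - {j}. ?D i)"
          using less.prems by (subst sum.remove[of _ j]) auto
        finally have "int p dvd ?D j + (\<Sum>i\<in>{..L} - {j}. ?D i)" .
        moreover have "int p dvd (\<Sum>i\<in>{..L} - {j}. ?D i)"
        proof (rule dvd_sum)
          fix i assume "i \<in> {..L} - {j}"
          then consider "i < j" | "n - j + i > n"
            using less.prems L by fastforce
          then show "int p dvd ?D i"
            using less high by cases (auto intro: dvd_mult dvd_mult2)
        qed
        ultimately have "int p dvd ?D j"
          by (simp add: dvd_add_left_iff)
        then show ?case
          using nz p less.prems L by (simp add: prime_dvd_mult_iff)
      qed
      \<comment> \<open>The change of basis keeps the leading coefficient 1, which p cannot
        divide.\<close>
      moreover have "d L = 1"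
        unfolding d_def lessThan_Suc_atMost[symmetric] by (simp add: a_def binomial_eq_0)
      ultimately show False
        using p1 by force
    qed
  qed
qed

section \<open>Euler quotients\<close>

lemma power_add_first_order:
  fixes x h :: "'a::comm_ring_1"
  shows "h\<^sup>2 dvd (x + h) ^ n - x ^ n - of_nat n * x ^ (n - 1) * h"
proof (induction n)
  case (Suc n)
  then obtain k where k: "(x + h) ^ n - x ^ n - of_nat n * x ^ (n - 1) * h = h\<^sup>2 * k"
    by (elim dvdE)
  \<comment> \<open>At n = 0 the exponent is truncated, but the factor n makes both sides
    zero.\<close>
  have "of_nat n * x ^ (n - 1) * x = of_nat n * x ^ n"
    by (cases n) simp_all
  then have "(x + h) ^ Suc n - x ^ Suc n - of_nat (Suc n) * x ^ (Suc n - 1) * h =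
      (x + h) * ((x + h) ^ n - x ^ n - of_nat n * x ^ (n - 1) * h) + h\<^sup>2 * (of_nat n * x ^ (n - 1))"
    by (simp add: algebra_simps power2_eq_square)
  then show ?case
    unfolding k by (metis dvd_add dvd_mult dvd_triv_left)
qed simp

text \<open>Expand (u + q l)^n modulo q^2, with q = \<open>p ^ k\<close> and n its totient, then
  cancel one factor q.\<close>

lemma euler_quotient_add:
  assumes "k > 0" "coprime u p"
  shows "[euler_quotient p k (u + p ^ k * l) =
    euler_quotient p k u + int (totient (p ^ k)) * int u ^ (totient (p ^ k) - 1) * int l]
    (mod int (p ^ k))"
proof (cases "p = 0")
  \<comment> \<open>Here q = 0 could not be cancelled, but the shift and the totient are both
    0.\<close>
  case True
  then show ?thesis
    using assms by (simp add: power_0_left)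
next
  case False
  define q where "q = int (p ^ k)"
  define n where "n = totient (p ^ k)"
  define w where "w = u + p ^ k * l"
  have q: "q \<noteq> 0"
    using False by (simp add: q_def)
  have w: "coprime w p"
  proof -
    have "p ^ k * l = l * p ^ (k - 1) * p"
      using assms by (cases k) simp_all
    then show ?thesis
      using assms unfolding w_def
      by (metis coprime_iff_gcd_eq_1 gcd_add_mult gcd.commute add.commute)
  qed
  \<comment> \<open>A and B are the Euler quotients before reduction modulo q.\<close>
  obtain A where A: "int u ^ n - 1 = q * A"
    using euler_quotient_dvd[OF assms(2), of k] unfolding q_def n_def by (elim dvdE)
  obtain B where B: "int w ^ n - 1 = q * B"
    using euler_quotient_dvd[OF w, of k] unfolding q_def n_def by (elim dvdE)
  have "q\<^sup>2 dvd (q * int l)\<^sup>2"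
    by (simp add: power_mult_distrib)
  also have "\<dots> dvd (int u + q * int l) ^ n - int u ^ n - of_nat n * int u ^ (n - 1) * (q * int l)"
    by (rule power_add_first_order)
  also have "int u + q * int l = int w"
    by (simp add: w_def q_def)
  also have "int w ^ n - int u ^ n - of_nat n * int u ^ (n - 1) * (q * int l) =
      q * (B - (A + int n * int u ^ (n - 1) * int l))"
    using A B by (simp add: algebra_simps)
  finally have "[B = A + int n * int u ^ (n - 1) * int l] (mod q)"
    using q by (simp add: power2_eq_square cong_iff_dvd_diff)
  moreover have "euler_quotient p k u = A mod q"
    unfolding euler_quotient_def q_def[symmetric] n_def[symmetric] A using assms(2) q by simp
  moreover have "euler_quotient p k w = B mod q"
    unfolding euler_quotient_def q_def[symmetric] n_def[symmetric] B using w q by simp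
  ultimately show ?thesis
    unfolding w_def[symmetric] q_def[symmetric] n_def[symmetric]
    by (simp add: cong_def mod_simps)
qed

lemma euler_quotient_not_coprime: "\<not> coprime u p \<Longrightarrow> euler_quotient p k u = 0"
  by (simp add: euler_quotient_def)

lemma coprime_prime_iff:
  fixes p u :: nat
  shows "prime p \<Longrightarrow> coprime u p \<longleftrightarrow> \<not> p dvd u"
  by (rule residues_prime.p_coprime_right) (rule residues_prime.intro)

lemma coprime_add_prime_power_iff:
  fixes p u :: nat
  assumes "prime p" "k > 0"
  shows "coprime (u + p ^ k) p \<longleftrightarrow> coprime u p"
proof -
  have "p dvd p ^ k"
    using assms by simp
  then show ?thesis
    using assms by (simp add: coprime_prime_iff dvd_add_left_iff)
qed

text \<open>For l = p the first-order term is a multiple of \<open>p ^ k\<close>, since p times the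
  totient is; reduced values then agree exactly.\<close>

lemma euler_quotient_period:
  assumes "prime p" "k > 0"
  shows "euler_quotient p k (u + p ^ Suc k) = euler_quotient p k u"
proof (cases "coprime u p")
  case True
  obtain j where k: "k = Suc j"
    using assms by (cases k) auto
  have "[euler_quotient p k (u + p ^ k * p) =
      euler_quotient p k u + int (totient (p ^ k)) * int u ^ (totient (p ^ k) - 1) * int p]
      (mod int (p ^ k))"
    by (rule euler_quotient_add[OF assms(2) True])
  also have "[euler_quotient p k u + int (totient (p ^ k)) * int u ^ (totient (p ^ k) - 1) * int p =
      euler_quotient p k u + 0] (mod int (p ^ k))"
    using assms by (intro cong_add cong_refl)
      (simp add: k totient_prime_power_Suc cong_0_iff del: power_Suc, simp)
  finally have "[euler_quotient p k (u + p ^ Suc k) = euler_quotient p k u] (mod int (p ^ k))"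
    by (simp add: mult.commute)
  moreover have "euler_quotient p k w mod int (p ^ k) = euler_quotient p k w" for w
    by (simp add: euler_quotient_def)
  ultimately show ?thesis
    unfolding cong_def by metis
next
  case False
  then have "\<not> coprime (u + p ^ Suc k) p"
    using coprime_add_prime_power_iff[of p "Suc k" u] assms by simp
  then show ?thesis
    using False by (simp add: euler_quotient_not_coprime del: power_Suc)
qed

lemma cong_power_totient_minus_1:
  assumes "prime p" "coprime u p"
  shows "[int u ^ (totient (p ^ Suc k) - 1) = int u ^ (p - 2)] (mod int p)"
proof -
  have p: "p \<ge> 2"
    using assms prime_ge_2_nat by simp
  have u: "[int u ^ (p - 1) = 1] (mod int p)"
    using euler_theorem[OF assms(2)] assms(1) by (metis cong_int_iff int_ops(2) of_nat_power totient_prime)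
  have t: "totient (p ^ Suc k) = (p - 1) * p ^ k"
    using assms by (simp only: totient_prime_power_Suc mult.commute)
  \<comment> \<open>With one more factor u, both sides are powers of u^(p-1), which Fermat makes 1;
    the unit u cancels at the end.\<close>
  have "int u * int u ^ (totient (p ^ Suc k) - 1) = (int u ^ (p - 1)) ^ (p ^ k)"
    using p unfolding t[symmetric] power_mult[symmetric]
    by (simp add: Suc_pred' flip: power_Suc)
  also have "[\<dots> = 1 ^ (p ^ k)] (mod int p)"
    by (rule cong_pow[OF u])
  also have "1 ^ (p ^ k) = (1 :: int)"
    by simp
  also have "[1 = int u ^ (p - 1)] (mod int p)"
    by (rule cong_sym[OF u])
  also have "int u ^ (p - 1) = int u * int u ^ (p - 2)"
    using p by (simp flip: power_Suc add: Suc_diff_Suc numeral_2_eq_2)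
  finally show ?thesis
    using assms(2) by (simp add: cong_mult_lcancel)
qed

text \<open>The totient \<open>p ^ k * (p - 1)\<close> supplies the factor \<open>p ^ k\<close>, and
  p - 1 is -1 modulo p. So only the top digit changes.\<close>

lemma euler_quotient_shift:
  assumes "prime p" "odd p"
  obtains w where "euler_quotient p (Suc k) (u + p ^ Suc k) = euler_quotient p (Suc k) u + int (p ^ k) * w"
    and "[w = - (int u ^ (p - 2))] (mod int p)"
proof (cases "coprime u p")
  case True
  have p: "p \<ge> 2"
    using assms prime_ge_2_nat by simp
  define v where "v = int u ^ (totient (p ^ Suc k) - 1)"
  have "[euler_quotient p (Suc k) (u + p ^ Suc k) =
      euler_quotient p (Suc k) u + int (p ^ k) * (int p - 1) * v] (mod int (p ^ Suc k))"
    using euler_quotient_add[of "Suc k" u p 1] True assms p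
    by (simp add: v_def totient_prime_power_Suc of_nat_diff del: power_Suc)
  then obtain m where m: "euler_quotient p (Suc k) (u + p ^ Suc k) =
      euler_quotient p (Suc k) u + int (p ^ k) * (int p - 1) * v + int (p ^ Suc k) * m"
    by (metis cong_iff_lin cong_sym)
  show thesis
  proof
    show "euler_quotient p (Suc k) (u + p ^ Suc k) =
        euler_quotient p (Suc k) u + int (p ^ k) * ((int p - 1) * v + int p * m)"
      unfolding m by (simp add: algebra_simps)
    have "[(int p - 1) * v + int p * m = - v] (mod int p)"
      by (simp add: cong_iff_dvd_diff algebra_simps)
    also have "[- v = - (int u ^ (p - 2))] (mod int p)"
      unfolding v_def cong_minus_minus_iff using assms True by (intro cong_power_totient_minus_1)
    finally show "[(int p - 1) * v + int p * m = - (int u ^ (p - 2))] (mod int p)" .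
  qed
next
  case False
  \<comment> \<open>Both quotients are 0; since p is odd, p - 2 > 0 and u^(p-2) vanishes modulo p
    too.\<close>
  show thesis
  proof (rule that[of 0])
    show "euler_quotient p (Suc k) (u + p ^ Suc k) = euler_quotient p (Suc k) u + int (p ^ k) * 0"
      using False coprime_add_prime_power_iff[of p "Suc k" u] assms
      by (simp add: euler_quotient_not_coprime del: power_Suc)
    have "p dvd u"
      using False assms by (simp add: coprime_prime_iff)
    moreover have "p - 2 > 0"
      using assms prime_gt_1_nat[of p] by (cases "p = 2") auto
    ultimately show "[0 = - (int u ^ (p - 2))] (mod int p)"
      by (simp add: cong_sym_eq[of 0] cong_0_iff dvd_power_same dvd_trans[OF _ dvd_power[of "p - 2"]])
  qed
qed

section \<open>The highest digit and its linear complexity\<close>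

lemma euler_digit_shift:
  assumes "prime p" "odd p"
  shows "[euler_digit p k (u + p ^ Suc k) - euler_digit p k u = - (int u ^ (p - 2))] (mod int p)"
proof -
  obtain w where w: "euler_quotient p (Suc k) (u + p ^ Suc k) =
      euler_quotient p (Suc k) u + int (p ^ k) * w"
    and cong_w: "[w = - (int u ^ (p - 2))] (mod int p)"
    using euler_quotient_shift[OF assms] by blast
  have "[euler_digit p k (u + p ^ Suc k) - euler_digit p k u = w] (mod int p)"
  proof (cases k)
    case 0
    then show ?thesis
      using w by simp
  next
    case (Suc j)
    have pos: "int (p ^ k) \<noteq> 0"
      using assms prime_gt_0_nat by simp
    let ?d = "(euler_quotient p (Suc k) u - euler_quotient p k u) div int (p ^ k)"
    \<comment> \<open>The lower quotient has period \<open>p ^ Suc k\<close>, so the numerator grows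
      by exactly \<open>p ^ k * w\<close> and its integer quotient by w.\<close>
    have "euler_quotient p (Suc k) (u + p ^ Suc k) - euler_quotient p k (u + p ^ Suc k) =
        (euler_quotient p (Suc k) u - euler_quotient p k u) + int (p ^ k) * w"
      using w euler_quotient_period[of p k u] assms Suc by simp
    then have "euler_digit p k (u + p ^ Suc k) = (?d + w) mod int p"
      using pos by (simp add: Suc add.commute del: power_Suc of_nat_power)
    moreover have "euler_digit p k u = ?d mod int p"
      by (simp add: Suc)
    ultimately show ?thesis
      by (simp add: cong_def mod_simps)
  qed
  then show ?thesis
    using cong_w by (rule cong_trans)
qed

lemma euler_digit_range:
  assumes "p > 0"
  shows "euler_digit p k u \<in> {0..<int p}"
  using assms by (cases k) (simp_all add: euler_quotient_def)

theorem theorem3: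
  fixes p r :: nat
  assumes "prime p" and "odd p" and "r \<ge> 1"
  shows "linear_complexity (residue_ring (int p)) (\<lambda>u. euler_digit p (r - 1) u) = p ^ r + p - 1"
proof -
  define s where "s = euler_digit p (r - 1)"
  define t :: "nat \<Rightarrow> int" where "t u = of_nat u ^ (p - 2)" for u
  have p: "p \<ge> 2"
    using assms prime_ge_2_nat by simp
  \<comment> \<open>The sign is kept as a factor \<open>- 1\<close> so that
    \<open>fdiff_funpow_cmult\<close> can pull it out.\<close>
  have st: "[(fdiff ^^ (p ^ r)) s u = - 1 * t u] (mod int p)" for u
    using cong_trans[OF cong_fdiff_prime_power[OF assms(1,2), of r s u]]
      euler_digit_shift[OF assms(1,2), of "r - 1" u] assms(3) by (simp add: s_def t_def)
  have *: "[(fdiff ^^ (m + p ^ r)) s u = - (fdiff ^^ m) t u] (mod int p)" for m u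
    using cong_fdiff_funpow[of "(fdiff ^^ (p ^ r)) s" "\<lambda>u. - 1 * t u" "int p" m u, OF st] unfolding fdiff_funpow_cmult by (simp add: funpow_add)
  have "linear_complexity (residue_ring (int p)) s = Suc (p - 2 + p ^ r)"
  proof (rule linear_complexity_fdiff[OF assms(1)])
    show "s u \<in> {0..<int p}" for u
      unfolding s_def using p by (intro euler_digit_range) simp
    show "int p dvd (fdiff ^^ Suc (p - 2 + p ^ r)) s u" for u
      using *[of "Suc (p - 2)" u] fdiff_funpow_power[of "p - 2" u, where 'a = int]
      by (simp add: cong_0_iff t_def[abs_def] del: funpow.simps)
    \<comment> \<open>The last nonvanishing difference is -(p - 2)!, a unit modulo p as p - 2 <
      p.\<close>
    have "\<not> p dvd fact (p - 2)"
      using assms p by (simp add: prime_dvd_fact_iff)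
    then have "\<not> int p dvd - (fdiff ^^ (p - 2)) t 0"
      using fdiff_funpow_power[of "p - 2" 0, where 'a = int]
      by (simp add: t_def[abs_def]) (metis int_dvd_int_iff of_nat_fact)
    then show "\<not> int p dvd (fdiff ^^ (p - 2 + p ^ r)) s 0"
      using *[of "p - 2" 0] by (simp add: cong_dvd_iff[symmetric] cong_dvd_iff)
  qed
  then show ?thesis
    using p by (simp add: s_def[abs_def])
qed

end
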